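(* Let $p\in(0,1)$ and $\psi\in L^p(\mathbb{R}^d)$, and assume that one of the following conditions holds: (a) $\psi\in L^1(\mathbb{R}^d)$ with $\int_{\mathbb{R}^d}\psi\,dx\ne0$; (b) $\psi\in L^1(\mathbb{R}^d)$ with $\int_{\mathbb{R}^d}\psi\,dx=0$, and $P\psi$ is not a.e. zero, is real-valued, and is bounded either above or below; (c) $P\psi\in L^2_{loc}(\mathbb{R}^d)$ with $p\int_{\mathcal{C}}|P\psi(bx)|^2\,dx<(2-p)\left|\int_{\mathcal{C}}(P\psi(bx))^2\,dx\right|$. Then for some $\lambda\in\mathbb{C}$ (in fact with $|\lambda|<1$), $$\|\lambda P\psi(b\,\cdot)-1\|_{L^p(\mathcal{C})}<1.$$ This conclusion holds also if $p=1$ and $\psi$ satisfies condition (a).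
   Context: Fix a dimension $d\in\mathbb{N}$ and an invertible real $d\times d$ matrix $b$. Functions are complex valued. $\mathcal{C}=[0,1)^d$, and $\|g\|_{L^p(\mathcal{C})}=(\int_{\mathcal{C}}|g|^p\,dx)^{1/p}$. Periodization: $P\psi(x)=|\det b|\sum_{k\in\mathbb{Z}^d}\psi(x-bk)$, which for $\psi\in L^p(\mathbb{R}^d)$, $p\in(0,1]$, converges absolutely a.e.; $P\psi(b\,\cdot)$ denotes $x\mapsto(P\psi)(bx)$, which belongs to $L^p(\mathcal{C})$. *)

theory Defs
  imports "HOL-Analysis.Analysis"
begin

(* Functions stand for their a.e.-classes. *)

definition Lp_space :: "'a measure \<Rightarrow> real \<Rightarrow> ('a \<Rightarrow> complex) set" where
  "Lp_space M p = {f \<in> borel_measurable M. integrable M (\<lambda>x. norm (f x) powr p)}"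

(* A quasi-norm for p < 1. The Bochner integral of a non-integrable function is 0, so the value
   is meaningful only for f in Lp_space M p. *)
definition Lp_norm :: "'a measure \<Rightarrow> real \<Rightarrow> ('a \<Rightarrow> complex) \<Rightarrow> real" where
  "Lp_norm M p f = (\<integral>x. norm (f x) powr p \<partial>M) powr (1 / p)"

definition Lp_loc :: "real \<Rightarrow> (real ^ 'n \<Rightarrow> complex) set" where
  "Lp_loc p = {f. \<forall>K. compact K \<longrightarrow> f \<in> Lp_space (lebesgue_on K) p}"

definition unit_cube :: "(real ^ 'n) set" where
  "unit_cube = {x. \<forall>i. 0 \<le> x $ i \<and> x $ i < 1}"

definition int_lattice :: "(real ^ 'n) set" where
  "int_lattice = {k. \<forall>i. k $ i \<in> \<int>}"

(* For complex-valued series infsum is the sum of an absolutely convergent series; it takes the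
   value 0 at the points where the series does not converge absolutely. *)
definition periodization :: "real ^ 'n ^ 'n \<Rightarrow> (real ^ 'n \<Rightarrow> complex) \<Rightarrow> real ^ 'n \<Rightarrow> complex" where
  "periodization b \<psi> x =
     complex_of_real \<bar>det b\<bar> * (\<Sum>\<^sub>\<infinity>k\<in>int_lattice. \<psi> (x - b *v k))"

definition cond_a :: "(real ^ 'n \<Rightarrow> complex) \<Rightarrow> bool" where
  "cond_a \<psi> \<longleftrightarrow> integrable lebesgue \<psi> \<and> (\<integral>x. \<psi> x \<partial>lebesgue) \<noteq> 0"

definition cond_b :: "real ^ 'n ^ 'n \<Rightarrow> (real ^ 'n \<Rightarrow> complex) \<Rightarrow> bool" where
  "cond_b b \<psi> \<longleftrightarrow>
     integrable lebesgue \<psi> \<and> (\<integral>x. \<psi> x \<partial>lebesgue) = 0 \<and>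
     \<not> (AE x in lebesgue. periodization b \<psi> x = 0) \<and>
     (AE x in lebesgue. periodization b \<psi> x \<in> \<real>) \<and>
     ((\<exists>B. AE x in lebesgue. Re (periodization b \<psi> x) \<le> B) \<or>
      (\<exists>B. AE x in lebesgue. Re (periodization b \<psi> x) \<ge> B))"

definition cond_c :: "real ^ 'n ^ 'n \<Rightarrow> real \<Rightarrow> (real ^ 'n \<Rightarrow> complex) \<Rightarrow> bool" where
  "cond_c b p \<psi> \<longleftrightarrow>
     periodization b \<psi> \<in> Lp_loc 2 \<and>
     p * (\<integral>x. (norm (periodization b \<psi> (b *v x)))\<^sup>2 \<partial>lebesgue_on unit_cube)
       < (2 - p) * norm (\<integral>x. (periodization b \<psi> (b *v x))\<^sup>2 \<partial>lebesgue_on unit_cube)"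

end

theory Submission
  imports Defs "HOL-Probability.Probability_Measure" "HOL-Real_Asymp.Real_Asymp"
begin

text \<open>
  Write \<open>g = P\<psi>(b \<cdot>)\<close> on the unit cube, a probability space. In case (a), tiling gives
  \<open>\<integral>g \<noteq> 0\<close>; after rotating \<open>g\<close> so that this mean is positive,
  \<open>(\<bar>1 - t g\<bar> - 1) / t \<rightarrow> - Re g\<close> as \<open>t \<rightarrow> 0\<close>, so the mean of \<open>\<bar>1 - t g\<bar>\<close> drops below 1, and
  \<open>y\<^sup>p \<le> 1 + p (y - 1)\<close> passes from the exponent 1 to \<open>p\<close>. In case (b), \<open>1 - t g \<ge> 0\<close> for small
  \<open>\<bar>t\<bar>\<close> of the right sign, and the same tangent bound is strict where \<open>g \<noteq> 0\<close>. In case (c), rotate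
  so that \<open>\<integral>g\<^sup>2 \<ge> 0\<close> and \<open>Re \<integral>g \<ge> 0\<close>; the coefficient of \<open>t\<^sup>2\<close> in \<open>\<integral>\<bar>1 - t g\<bar>\<^sup>p\<close> is then
  \<open>p/4 (p \<integral>\<bar>g\<bar>\<^sup>2 - (2 - p) \<bar>\<integral>g\<^sup>2\<bar>) < 0\<close>.
\<close>

section \<open>Functions close to 1 on a probability space\<close>

lemma powr_le_tangent:
  fixes y a :: real
  assumes "0 \<le> y" "0 \<le> a" "a \<le> 1"
  shows "y powr a \<le> 1 + a * (y - 1)"
proof (cases "y = 0")
  case False
  then show ?thesis
    using Youngs_inequality_0[of a "1 - a" y 1] assms by (auto simp: algebra_simps)
qed (use assms in auto)

text \<open>Strictness comes from the weak bound at the square root \<open>s\<close> of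
  \<open>y\<close>: squaring it leaves the gap \<open>a * (1 - a) * (s - 1)\<^sup>2\<close>,
  positive when \<open>s\<close> differs from 1.\<close>

lemma powr_less_tangent:
  fixes y a :: real
  assumes "0 \<le> y" "y \<noteq> 1" "0 < a" "a < 1"
  shows "y powr a < 1 + a * (y - 1)"
proof -
  define s where "s = sqrt y"
  have s: "0 \<le> s" "y = s * s" "s \<noteq> 1"
    using assms by (auto simp: s_def)
  have nonneg: "0 \<le> 1 + a * (s - 1)"
  proof -
    have "0 \<le> a * s"
      using s assms by simp
    then show ?thesis
      using assms by (simp only: right_diff_distrib mult_1_right)
  qed
  have "y powr a = (s powr a) * (s powr a)"
    using s by (simp add: powr_mult)
  also have "\<dots> \<le> (1 + a * (s - 1)) * (1 + a * (s - 1))"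
    using s assms nonneg powr_le_tangent[of s a] by (intro mult_mono) auto
  also have "\<dots> = 1 + a * (y - 1) - a * (1 - a) * (s - 1)\<^sup>2"
    by (simp add: s power2_eq_square algebra_simps)
  also have "\<dots> < 1 + a * (y - 1)"
    using s assms by simp
  finally show ?thesis .
qed

text \<open>With v = - 2 t r + t^2 s, expand (1 + v)^a = 1 + a v + a (a - 1) v^2 / 2 + ...; the
  linear term - 2 a t r is removed and the limit collects the t^2 terms. The sequence t = 1 / (n +
  2) suits dominated convergence and is below 1 already at n = 0.\<close>

lemma tendsto_second_order_powr:
  fixes a r s :: real
  shows "(\<lambda>n. ((1 - 2 * (1 / real (n + 2)) * r + (1 / real (n + 2))\<^sup>2 * s) powr a - 1
            + 2 * a * (1 / real (n + 2)) * r) / (1 / real (n + 2))\<^sup>2)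
     \<longlonglongrightarrow> a * s + 2 * a * (a - 1) * r\<^sup>2"
proof -
  \<comment> \<open>The limit is rewritten into the shape in which \<open>real_asymp\<close>
    computes it.\<close>
  have eq: "a * s + 2 * a * (a - 1) * r\<^sup>2 = 2 * r * (r * ((a - 1) * a)) + (4 * r + s) * a - 4 * a * r"
    by (simp add: algebra_simps power2_eq_square)
  show ?thesis
    unfolding eq by real_asymp
qed

lemma tendsto_first_order_sqrt:
  fixes r s :: real
  shows "(\<lambda>n. (sqrt (1 - 2 * (1 / real (n + 2)) * r + (1 / real (n + 2))\<^sup>2 * s) - 1) / (1 / real (n + 2)))
     \<longlonglongrightarrow> - r"
  by real_asymp

lemma norm_one_minus_sq:
  "(norm (1 - of_real t * z))\<^sup>2 = 1 - 2 * t * Re z + t\<^sup>2 * (norm z)\<^sup>2" for z :: complex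
  unfolding cmod_power2 by (simp add: power2_eq_square algebra_simps)

lemma norm_one_minus:
  "norm (1 - of_real t * z) = sqrt (1 - 2 * t * Re z + t\<^sup>2 * (norm z)\<^sup>2)" for z :: complex
  by (metis norm_ge_zero norm_one_minus_sq real_sqrt_unique)

lemma norm_one_minus_powr:
  "norm (1 - of_real t * z) powr p = (1 - 2 * t * Re z + t\<^sup>2 * (norm z)\<^sup>2) powr (p / 2)" for z :: complex
proof -
  have "norm (1 - of_real t * z) = (1 - 2 * t * Re z + t\<^sup>2 * (norm z)\<^sup>2) powr (1 / 2)"
    unfolding norm_one_minus by (rule powr_half_sqrt[symmetric]) (metis norm_one_minus_sq zero_le_power2)
  then show ?thesis
    by (simp add: powr_powr)
qed

text \<open>Membership in \<open>Lp_space\<close> makes the \<open>Lp_norm\<close> meaningful;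
  otherwise a nonintegrable power would count as norm 0.\<close>

definition approximates_one :: "'a measure \<Rightarrow> real \<Rightarrow> ('a \<Rightarrow> complex) \<Rightarrow> bool" where
  "approximates_one M p g \<longleftrightarrow> (\<exists>c. norm c < 1 \<and>
     (\<lambda>x. c * g x - 1) \<in> Lp_space M p \<and> Lp_norm M p (\<lambda>x. c * g x - 1) < 1)"

section \<open>Criteria on a probability space for the three conditions\<close>

lemma (in prob_space) integrable_norm_powr:
  fixes f :: "'a \<Rightarrow> complex"
  assumes "integrable M f" "0 < p" "p \<le> 1"
  shows "integrable M (\<lambda>x. norm (f x) powr p)"
proof (rule Bochner_Integration.integrable_bound)
  show "integrable M (\<lambda>x. 1 + norm (f x))"
    using assms by auto
  show "(\<lambda>x. norm (f x) powr p) \<in> borel_measurable M"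
    using borel_measurable_integrable[OF assms(1)] by measurable
  \<comment> \<open>The tangent bound at 1 dominates the power by an integrable function, constants
    being integrable for a finite measure.\<close>
  have "norm (f x) powr p \<le> 1 + norm (f x)" for x
  proof -
    have "p * (norm (f x) - 1) \<le> norm (f x)"
      using assms mult_mono[of p 1 "norm (f x)" "norm (f x)"] by (auto simp: right_diff_distrib)
    then show ?thesis
      using powr_le_tangent[of "norm (f x)" p] assms by auto
  qed
  then show "AE x in M. norm (norm (f x) powr p) \<le> norm (1 + norm (f x))"
    by auto
qed

text \<open>A unimodular \<open>w\<close> and a small \<open>t\<close> combine into the multiplier c
  = t w with |c| = t. The outer exponent 1 / p in \<open>Lp_norm\<close> keeps a nonnegative
  integral below 1.\<close>

lemma (in prob_space) approximates_one_rotateI: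
  fixes g :: "'a \<Rightarrow> complex"
  assumes g: "integrable M g" and p: "0 < p" "p \<le> 1" and w: "norm w = 1" and t: "0 < t" "t < 1"
    and less: "(\<integral>x. norm (1 - of_real t * (w * g x)) powr p \<partial>M) < 1"
  shows "approximates_one M p g"
proof -
  have [measurable]: "g \<in> borel_measurable M"
    using g by auto
  have "(\<lambda>x. of_real t * w * g x - 1) \<in> Lp_space M p"
    unfolding Lp_space_def using g p by (auto intro!: integrable_norm_powr)
  moreover have "Lp_norm M p (\<lambda>x. of_real t * w * g x - 1) < 1"
  proof -
    have "norm (of_real t * w * g x - 1) = norm (1 - of_real t * (w * g x))" for x
      by (simp add: norm_minus_commute mult.assoc)
    moreover have "0 \<le> (\<integral>x. norm (1 - of_real t * (w * g x)) powr p \<partial>M)"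
      by (intro integral_nonneg_AE) auto
    ultimately show ?thesis
      using less p powr_less_mono2[of "1 / p" _ 1] by (simp add: Lp_norm_def)
  qed
  ultimately show ?thesis
    using w t unfolding approximates_one_def
    by (intro exI[of _ "of_real t * w"]) (auto simp: norm_mult)
qed

lemma (in prob_space) approximates_one_nonzero_mean:
  fixes g :: "'a \<Rightarrow> complex"
  assumes g: "integrable M g" and nz: "(\<integral>x. g x \<partial>M) \<noteq> 0" and p: "0 < p" "p \<le> 1"
  shows "approximates_one M p g"
proof -
  define m where "m = (\<integral>x. g x \<partial>M)"
  \<comment> \<open>Multiplication by the conjugate phase of \<open>m\<close> turns the mean into
    |m|.\<close>
  define w where "w = of_real (norm m) / m"
  define h where "h x = w * g x" for x
  define t :: "nat \<Rightarrow> real" where "t n = 1 / real (n + 2)" for n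
  have w: "norm w = 1"
    using nz by (auto simp: w_def m_def norm_divide)
  have t: "0 < t n" "t n < 1" for n
    by (auto simp: t_def)
  have h: "integrable M h"
    using g by (auto simp: h_def[abs_def])
  have [measurable]: "h \<in> borel_measurable M"
    using h by auto
  have int_h: "(\<integral>x. Re (h x) \<partial>M) = norm m"
  proof -
    have "(\<integral>x. h x \<partial>M) = of_real (norm m)"
      using nz by (simp add: h_def w_def m_def)
    then show ?thesis
      using h by simp
  qed
  have "(\<lambda>n. \<integral>x. (norm (1 - of_real (t n) * h x) - 1) / t n \<partial>M) \<longlonglongrightarrow> (\<integral>x. - Re (h x) \<partial>M)"
  proof (rule integral_dominated_convergence[where w = "\<lambda>x. norm (h x)"])
    show "AE x in M. (\<lambda>n. (norm (1 - of_real (t n) * h x) - 1) / t n) \<longlonglongrightarrow> - Re (h x)"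
      unfolding norm_one_minus t_def by (intro AE_I2 tendsto_first_order_sqrt)
    fix n
    \<comment> \<open>Reverse triangle inequality: |1 - t h| differs from 1 by at most t |h|, so the
      quotients are dominated uniformly in n.\<close>
    show "AE x in M. norm ((norm (1 - of_real (t n) * h x) - 1) / t n) \<le> norm (h x)"
    proof (rule AE_I2)
      fix x
      show "norm ((norm (1 - of_real (t n) * h x) - 1) / t n) \<le> norm (h x)"
        using norm_triangle_ineq3[of "1 - of_real (t n) * h x" 1] t[of n]
        by (simp add: norm_mult field_simps)
    qed
  qed (use h in auto)
  then have "(\<lambda>n. \<integral>x. (norm (1 - of_real (t n) * h x) - 1) / t n \<partial>M) \<longlonglongrightarrow> - norm m"
    using h int_h by simp
  moreover have "- norm m < 0"
    using nz by (simp add: m_def)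
  ultimately have "eventually (\<lambda>n. (\<integral>x. (norm (1 - of_real (t n) * h x) - 1) / t n \<partial>M) < 0) sequentially"
    by (rule order_tendstoD)
  then obtain n where "(\<integral>x. (norm (1 - of_real (t n) * h x) - 1) / t n \<partial>M) < 0"
    unfolding eventually_sequentially by auto
  then have "(\<integral>x. norm (1 - of_real (t n) * h x) - 1 \<partial>M) < 0"
    using t[of n] by (simp add: divide_less_0_iff)
  then have less: "(\<integral>x. norm (1 - of_real (t n) * h x) \<partial>M) < 1"
    using h by (simp add: prob_space)
  \<comment> \<open>The integrated tangent bound passes from exponent 1 to \<open>p\<close>, with p
    = 1 included.\<close>
  have "(\<integral>x. norm (1 - of_real (t n) * h x) powr p \<partial>M)
      \<le> (\<integral>x. 1 + p * (norm (1 - of_real (t n) * h x) - 1) \<partial>M)"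
    using h p by (intro integral_mono integrable_norm_powr powr_le_tangent) auto
  also have "\<dots> = 1 + p * ((\<integral>x. norm (1 - of_real (t n) * h x) \<partial>M) - 1)"
    using h by (simp add: prob_space)
  also have "\<dots> < 1"
    using less p by (simp add: mult_less_0_iff)
  finally show ?thesis
    using g p w t by (intro approximates_one_rotateI[of g p w "t n"]) (auto simp: h_def)
qed

text \<open>The sign \<open>w\<close> lets one argument serve both upper and lower bounds of a
  real-valued \<open>g\<close>.\<close>

lemma (in prob_space) approximates_one_bounded_above:
  fixes g :: "'a \<Rightarrow> complex"
  assumes g: "integrable M g" and zero: "(\<integral>x. g x \<partial>M) = 0" and nz: "\<not> (AE x in M. g x = 0)"
    and w: "w = 1 \<or> w = - 1"
    and real: "AE x in M. g x \<in> \<real>" and B: "AE x in M. Re (w * g x) \<le> B" and p: "0 < p" "p < 1"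
  shows "approximates_one M p g"
proof -
  have [measurable]: "g \<in> borel_measurable M"
    using g by auto
  \<comment> \<open>This choice gives \<open>t * B \<le> 1\<close>, hence 1 - t Re (w g) \<ge> 0,
    and also \<open>t < 1\<close>, whatever the sign of \<open>B\<close>.\<close>
  define t where "t = 1 / (\<bar>B\<bar> + 2)"
  have t: "0 < t" "t < 1" "t * B \<le> 1"
    by (auto simp: t_def field_simps)
  define u where "u x = 1 - t * Re (w * g x)" for x
  have u: "integrable M u"
    using g w by (auto simp: u_def[abs_def])
  have int_u: "(\<integral>x. u x \<partial>M) = 1"
  proof -
    have "(\<integral>x. Re (w * g x) \<partial>M) = 0"
      using g zero integral_Re[of M "\<lambda>x. w * g x"] by simp
    then show ?thesis
      using g by (simp add: u_def prob_space)
  qed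
  have "AE x in M. 0 \<le> u x"
    using B
  proof eventually_elim
    case (elim x)
    then show ?case
      using t mult_left_mono[of "Re (w * g x)" B t] unfolding u_def by linarith
  qed
  \<comment> \<open>For real \<open>g\<close> and nonnegative \<open>u\<close> the modulus is affine
    in \<open>g\<close>, so the zero mean gives it integral exactly 1.\<close>
  have eq: "AE x in M. norm (1 - of_real t * (w * g x)) = u x"
    using real \<open>AE x in M. 0 \<le> u x\<close>
  proof eventually_elim
    case (elim x)
    then have "1 - of_real t * (w * g x) = of_real (u x)"
      using w by (auto simp: u_def complex_eq_iff complex_is_Real_iff)
    then show ?case
      using elim by (simp add: norm_of_real)
  qed
  have int: "integrable M (\<lambda>x. norm (1 - of_real t * (w * g x)) powr p)"
    using g p by (intro integrable_norm_powr) auto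
  have le: "AE x in M. norm (1 - of_real t * (w * g x)) powr p \<le> 1 + p * (u x - 1)"
    using eq by eventually_elim (use p powr_le_tangent in \<open>metis less_imp_le norm_ge_zero\<close>)
  \<comment> \<open>The tangent bound is an equality only where \<open>u\<close> is 1, which for
    real \<open>g\<close> means \<open>g\<close> is 0; the set where \<open>g\<close> is nonzero has
    positive measure.\<close>
  have "(\<integral>x. norm (1 - of_real t * (w * g x)) powr p \<partial>M) < (\<integral>x. 1 + p * (u x - 1) \<partial>M)"
  proof (rule integral_less_AE[where A = "{x \<in> space M. g x \<noteq> 0}"])
    show "emeasure M {x \<in> space M. g x \<noteq> 0} \<noteq> 0"
      using nz by (subst (asm) AE_iff_measurable[OF _ refl]) auto
    show "AE x in M. x \<in> {x \<in> space M. g x \<noteq> 0} \<longrightarrow>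
        norm (1 - of_real t * (w * g x)) powr p \<noteq> 1 + p * (u x - 1)"
      using eq real \<open>AE x in M. 0 \<le> u x\<close>
    proof eventually_elim
      case (elim x)
      show ?case
      proof
        assume "x \<in> {x \<in> space M. g x \<noteq> 0}"
        then have "u x \<noteq> 1"
          using elim t w by (auto simp: u_def complex_eq_iff complex_is_Real_iff)
        then show "norm (1 - of_real t * (w * g x)) powr p \<noteq> 1 + p * (u x - 1)"
          using powr_less_tangent[of "u x" p] elim p by simp
      qed
    qed
  qed (use int le u in auto)
  also have "\<dots> = 1"
    using u by (simp add: int_u prob_space)
  finally show ?thesis
    using g p w t by (intro approximates_one_rotateI[of g p w t]) auto
qed

lemma (in prob_space) approximates_one_square:
  fixes g :: "'a \<Rightarrow> complex"
  assumes [measurable]: "g \<in> borel_measurable M" and g2: "integrable M (\<lambda>x. (norm (g x))\<^sup>2)"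
    and less: "p * (\<integral>x. (norm (g x))\<^sup>2 \<partial>M) < (2 - p) * norm (\<integral>x. (g x)\<^sup>2 \<partial>M)" and p: "0 < p" "p < 1"
  shows "approximates_one M p g"
proof -
  \<comment> \<open>On a finite measure space y \<le> 1 + y^2 puts L^2 into L^1.\<close>
  have g: "integrable M g"
  proof (rule Bochner_Integration.integrable_bound)
    show "integrable M (\<lambda>x. 1 + (norm (g x))\<^sup>2)"
      using g2 by simp
    have "norm (g x) \<le> 1 + (norm (g x))\<^sup>2" for x
      using zero_le_power2[of "norm (g x) - 1"] by (simp add: power2_diff) (smt (verit) norm_ge_zero)
    then show "AE x in M. norm (g x) \<le> norm (1 + (norm (g x))\<^sup>2)"
      by auto
  qed simp
  define m where "m = (\<integral>x. (g x)\<^sup>2 \<partial>M)"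
  \<comment> \<open>Otherwise the strict hypothesis would make the integral of |g|^2
    negative.\<close>
  have "m \<noteq> 0"
  proof
    assume "m = 0"
    then have "(\<integral>x. (norm (g x))\<^sup>2 \<partial>M) < 0"
      using less p by (auto simp: m_def mult_less_0_iff)
    moreover have "0 \<le> (\<integral>x. (norm (g x))\<^sup>2 \<partial>M)"
      by simp
    ultimately show False
      by simp
  qed
  \<comment> \<open>The equation w^2 = |m| / m has two roots, opposite to each other. Both turn the
    integral of (w g)^2 into |m|, and at least one gives the mean a nonnegative real part.\<close>
  obtain w where w: "norm w = 1" "w\<^sup>2 * m = of_real (norm m)" "0 \<le> Re (w * (\<integral>x. g x \<partial>M))"
  proof -
    define v where "v = csqrt (of_real (norm m) / m)"
    have v: "v\<^sup>2 = of_real (norm m) / m"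
      by (simp add: v_def)
    then have "(norm v)\<^sup>2 = 1"
      using \<open>m \<noteq> 0\<close> by (simp add: norm_power[symmetric] norm_divide)
    then have "norm v = 1"
      using norm_ge_zero[of v] by (simp add: power2_eq_1_iff)
    show thesis
    proof (cases "0 \<le> Re (v * (\<integral>x. g x \<partial>M))")
      case True
      then show thesis
        using that[of v] v \<open>norm v = 1\<close> \<open>m \<noteq> 0\<close> by simp
    next
      case False
      then show thesis
        using that[of "- v"] v \<open>norm v = 1\<close> \<open>m \<noteq> 0\<close> by simp
    qed
  qed
  define h where "h x = w * g x" for x
  define t :: "nat \<Rightarrow> real" where "t n = 1 / real (n + 2)" for n
  have t: "0 < t n" "t n < 1" for n
    by (auto simp: t_def)
  have h: "integrable M h"
    using g by (auto simp: h_def[abs_def])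
  have [measurable]: "h \<in> borel_measurable M"
    using h by auto
  have norm_h: "norm (h x) = norm (g x)" for x
    using w by (simp add: h_def norm_mult)
  have h2: "integrable M (\<lambda>x. (norm (h x))\<^sup>2)"
    using g2 by (simp add: norm_h)
  have hsq: "integrable M (\<lambda>x. (h x)\<^sup>2)"
    by (rule Bochner_Integration.integrable_bound[OF h2]) (auto simp: norm_power)
  have int_hsq: "(\<integral>x. Re ((h x)\<^sup>2) \<partial>M) = norm m"
  proof -
    have "(\<integral>x. (h x)\<^sup>2 \<partial>M) = of_real (norm m)"
      using w by (simp add: h_def power_mult_distrib m_def)
    then show ?thesis
      using hsq by simp
  qed
  have int_h: "0 \<le> (\<integral>x. Re (h x) \<partial>M)"
  proof -
    have "(\<integral>x. Re (h x) \<partial>M) = Re (\<integral>x. h x \<partial>M)"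
      using h by simp
    also have "(\<integral>x. h x \<partial>M) = w * (\<integral>x. g x \<partial>M)"
      by (simp add: h_def)
    finally show ?thesis
      using w by simp
  qed
  \<comment> \<open>\<open>q\<close> is the second-order quotient with the linear term removed, and
    \<open>l\<close> its limit by \<open>tendsto_second_order_powr\<close> at a = p / 2; the
    exponent is halved because the squared modulus is expanded.\<close>
  define q where "q n x = (norm (1 - of_real (t n) * h x) powr p - 1 + p * t n * Re (h x)) / (t n)\<^sup>2" for n x
  define l where "l x = p / 2 * (norm (h x))\<^sup>2 + p * (p / 2 - 1) * (Re (h x))\<^sup>2" for x
  \<comment> \<open>From Re (z^2) = 2 (Re z)^2 - |z|^2; in this form \<open>l\<close> integrates to
    a multiple of the difference in the hypothesis.\<close>
  have l_eq: "l x = p\<^sup>2 / 4 * (norm (h x))\<^sup>2 - p * (2 - p) / 4 * Re ((h x)\<^sup>2)" for x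
    unfolding l_def cmod_power2 by (simp add: power2_eq_square field_simps)
  \<comment> \<open>This bound makes the later truncation of \<open>q n\<close> invisible in the
    limit.\<close>
  have l_ge: "- p * (norm (h x))\<^sup>2 \<le> l x" for x
  proof -
    have "p * (1 - p / 2) * (Re (h x))\<^sup>2 \<le> p * 1 * (norm (h x))\<^sup>2"
      using p abs_Re_le_cmod[of "h x"] by (intro mult_mono) (auto simp: power2_le_iff_abs_le)
    moreover have "0 \<le> p / 2 * (norm (h x))\<^sup>2"
      using p by simp
    ultimately show ?thesis
      by (simp add: l_def algebra_simps)
  qed
  have q_lim: "(\<lambda>n. q n x) \<longlonglongrightarrow> l x" for x
    using tendsto_second_order_powr[of "Re (h x)" "(norm (h x))\<^sup>2" "p / 2"]
    unfolding q_def l_def norm_one_minus_powr t_def by simp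
  \<comment> \<open>In the tangent bound for exponent p / 2 at the squared modulus the linear terms
    cancel, leaving a bound independent of n.\<close>
  have q_le: "q n x \<le> p * (norm (h x))\<^sup>2" for n x
  proof -
    have "0 \<le> 1 - 2 * t n * Re (h x) + (t n)\<^sup>2 * (norm (h x))\<^sup>2"
      using norm_one_minus_sq[of "t n" "h x"] by (metis zero_le_power2)
    then have "norm (1 - of_real (t n) * h x) powr p
        \<le> 1 + p / 2 * (1 - 2 * t n * Re (h x) + (t n)\<^sup>2 * (norm (h x))\<^sup>2 - 1)"
      unfolding norm_one_minus_powr using p by (intro powr_le_tangent) auto
    then have "norm (1 - of_real (t n) * h x) powr p - 1 + p * t n * Re (h x)
        \<le> p / 2 * (norm (h x))\<^sup>2 * (t n)\<^sup>2"
      by (simp add: algebra_simps)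
    then have "q n x \<le> p / 2 * (norm (h x))\<^sup>2"
      using t[of n] by (simp add: q_def divide_le_eq)
    also have "\<dots> \<le> p * (norm (h x))\<^sup>2"
      using p by (intro mult_right_mono) auto
    finally show ?thesis .
  qed
  have q_int: "integrable M (q n)" for n
  proof -
    have "integrable M (\<lambda>x. norm (1 - of_real (t n) * h x) powr p)"
      using h p by (intro integrable_norm_powr) auto
    then show ?thesis
      unfolding q_def[abs_def] using h by simp
  qed
  have l_int: "integrable M l"
    unfolding l_eq[abs_def] using h2 hsq by auto
  have [measurable]: "q n \<in> borel_measurable M" "l \<in> borel_measurable M" for n
    using q_int l_int by auto
  \<comment> \<open>Only an upper bound on the integral of \<open>q n\<close> is needed, so truncation from below supplies the lower half of a dominating function.\<close>
  have "(\<lambda>n. \<integral>x. max (q n x) (- p * (norm (h x))\<^sup>2) \<partial>M) \<longlonglongrightarrow> (\<integral>x. l x \<partial>M)"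
  proof (rule integral_dominated_convergence[where w = "\<lambda>x. p * (norm (h x))\<^sup>2"])
    show "AE x in M. (\<lambda>n. max (q n x) (- p * (norm (h x))\<^sup>2)) \<longlonglongrightarrow> l x"
    proof (rule AE_I2)
      fix x
      have "(\<lambda>n. max (q n x) (- p * (norm (h x))\<^sup>2)) \<longlonglongrightarrow> max (l x) (- p * (norm (h x))\<^sup>2)"
        by (intro tendsto_max q_lim tendsto_const)
      then show "(\<lambda>n. max (q n x) (- p * (norm (h x))\<^sup>2)) \<longlonglongrightarrow> l x"
        using l_ge[of x] by (simp add: max_def)
    qed
    fix n
    show "AE x in M. norm (max (q n x) (- p * (norm (h x))\<^sup>2)) \<le> p * (norm (h x))\<^sup>2"
    proof (rule AE_I2)
      fix x
      show "norm (max (q n x) (- p * (norm (h x))\<^sup>2)) \<le> p * (norm (h x))\<^sup>2"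
        using q_le[of n x] p by (auto simp: max_def abs_if)
    qed
  qed (use h2 in auto)
  moreover have "(\<integral>x. l x \<partial>M) < 0"
  proof -
    have "integrable M (\<lambda>x. Re ((h x)\<^sup>2))"
      using hsq by (rule integrable_Re)
    then have "(\<integral>x. l x \<partial>M) = p\<^sup>2 / 4 * (\<integral>x. (norm (h x))\<^sup>2 \<partial>M)
        - p * (2 - p) / 4 * (\<integral>x. Re ((h x)\<^sup>2) \<partial>M)"
      unfolding l_eq using h2
      by (subst Bochner_Integration.integral_diff) (simp_all only: integrable_mult_right integral_mult_right_zero)
    also have "\<dots> = p / 4 * (p * (\<integral>x. (norm (h x))\<^sup>2 \<partial>M) - (2 - p) * norm m)"
      unfolding int_hsq by (simp add: power2_eq_square field_simps)
    also have "\<dots> < 0"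
      using less p by (intro mult_pos_neg) (auto simp: norm_h m_def)
    finally show ?thesis .
  qed
  ultimately have "eventually (\<lambda>n. (\<integral>x. max (q n x) (- p * (norm (h x))\<^sup>2) \<partial>M) < 0) sequentially"
    by (rule order_tendstoD)
  then obtain n where "(\<integral>x. max (q n x) (- p * (norm (h x))\<^sup>2) \<partial>M) < 0"
    unfolding eventually_sequentially by auto
  moreover have "(\<integral>x. q n x \<partial>M) \<le> (\<integral>x. max (q n x) (- p * (norm (h x))\<^sup>2) \<partial>M)"
    using q_int h2 by (intro integral_mono) auto
  ultimately have "(\<integral>x. q n x \<partial>M) < 0"
    by simp
  then have "(\<integral>x. norm (1 - of_real (t n) * h x) powr p - 1 + p * t n * Re (h x) \<partial>M) < 0"
    using t[of n] by (simp add: q_def divide_less_0_iff)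
  also have "(\<integral>x. norm (1 - of_real (t n) * h x) powr p - 1 + p * t n * Re (h x) \<partial>M) =
      (\<integral>x. norm (1 - of_real (t n) * h x) powr p \<partial>M) - 1 + p * t n * (\<integral>x. Re (h x) \<partial>M)"
  proof -
    have "integrable M (\<lambda>x. norm (1 - of_real (t n) * h x) powr p)"
      using h p by (intro integrable_norm_powr) auto
    then show ?thesis
      using h by (simp add: prob_space)
  qed
  finally have "(\<integral>x. norm (1 - of_real (t n) * h x) powr p \<partial>M) < 1 - p * t n * (\<integral>x. Re (h x) \<partial>M)"
    by simp
  \<comment> \<open>Here the sign of \<open>w\<close> matters: with a nonnegative mean of Re h the
    linear term can only lower the integral.\<close>
  also have "\<dots> \<le> 1"
    using int_h p t[of n] by simp
  finally show ?thesis
    using g p w t by (intro approximates_one_rotateI[of g p w "t n"]) (auto simp: h_def)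
qed

section \<open>Linear images of Lebesgue measure\<close>

lemma nn_integral_lborel_translate:
  fixes f :: "'a::euclidean_space \<Rightarrow> ennreal"
  assumes [measurable]: "f \<in> borel_measurable borel"
  shows "(\<integral>\<^sup>+x. f (t + x) \<partial>lborel) = (\<integral>\<^sup>+x. f x \<partial>lborel)"
proof -
  have "(\<integral>\<^sup>+x. f x \<partial>lborel) = (\<integral>\<^sup>+x. f x \<partial>distr lborel borel ((+) t))"
    by (simp add: lborel_distr_plus)
  then show ?thesis
    by (simp add: nn_integral_distr)
qed

lemma nn_integral_lborel_reflect:
  fixes f :: "'a::euclidean_space \<Rightarrow> ennreal"
  assumes [measurable]: "f \<in> borel_measurable borel"
  shows "(\<integral>\<^sup>+x. f (t - x) \<partial>lborel) = (\<integral>\<^sup>+x. f x \<partial>lborel)"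
proof -
  have "lborel = distr lborel borel (\<lambda>x::'a. t - x)"
    using lborel_affine[of "-1" t] by (simp add: density_1)
  then have "(\<integral>\<^sup>+x. f x \<partial>lborel) = (\<integral>\<^sup>+x. f x \<partial>distr lborel borel (\<lambda>x. t - x))"
    by simp
  then show ?thesis
    by (simp add: nn_integral_distr)
qed

text \<open>
  The image measure is translation invariant, so Fubini's theorem with an auxiliary function of
  integral 1 shows that it is a multiple of Lebesgue measure. That the factor is
  \<open>1 / \<bar>det T\<bar>\<close> is irrelevant here.
\<close>
lemma nn_integral_lborel_linear:
  fixes T :: "'a::euclidean_space \<Rightarrow> 'a"
  assumes "linear T" "bij T"
  obtains c :: real where "0 < c"
    "\<And>f. f \<in> borel_measurable borel \<Longrightarrow> (\<integral>\<^sup>+x. f (T x) \<partial>lborel) = ennreal c * (\<integral>\<^sup>+x. f x \<partial>lborel)"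
proof -
  \<comment> \<open>A bounded, open, nonempty set of volume 1: its preimage has finite positive
    measure, and its indicator is the auxiliary function.\<close>
  define Q :: "'a set" where "Q = box 0 One"
  define c where "c = measure lborel (T -` Q)"
  have contT: "continuous_on UNIV T"
    using assms(1) by (simp add: linear_continuous_on linear_linear)
  then have [measurable]: "T \<in> borel_measurable borel"
    by (rule borel_measurable_continuous_onI)
  have lin_inv: "linear (inv T)"
    using assms by (metis bij_betw_imp_inj_on bij_is_surj inj_linear_imp_inv_linear)
  have preimage: "T -` Q = inv T ` Q"
    using assms(2) by (simp add: bij_vimage_eq_inv_image)
  have "bounded (T -` Q)"
    unfolding preimage using lin_inv by (intro bounded_linear_image) (auto simp: Q_def linear_linear)
  then have fin: "emeasure lborel (T -` Q) < \<infinity>"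
    by (rule emeasure_bounded_finite)
  have op: "open (T -` Q)"
    unfolding Q_def using contT by (intro open_vimage) auto
  have "Q \<noteq> {}"
    by (auto simp: Q_def box_ne_empty)
  then have "T -` Q \<noteq> {}"
    unfolding preimage by simp
  then have "\<not> negligible (T -` Q)"
    using op open_not_negligible by blast
  then have "T -` Q \<notin> null_sets lborel"
    using op by (simp add: negligible_iff_null_sets null_sets_completion_iff)
  then have nonzero: "emeasure lborel (T -` Q) \<noteq> 0"
    using op by (auto simp: null_sets_def)
  have c_eq: "emeasure lborel (T -` Q) = ennreal c"
    unfolding c_def using fin by (intro emeasure_eq_ennreal_measure) simp
  with nonzero have c_pos: "0 < c"
    by (metis c_def ennreal_0 less_le measure_nonneg)
  have Q1: "(\<integral>\<^sup>+y. indicator Q y \<partial>lborel) = (1::ennreal)"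
    by (simp add: Q_def emeasure_lborel_box_eq)
  have "(\<integral>\<^sup>+x. f (T x) \<partial>lborel) = ennreal c * (\<integral>\<^sup>+x. f x \<partial>lborel)"
    if [measurable]: "f \<in> borel_measurable borel" for f
  proof -
    let ?h = "indicator Q :: 'a \<Rightarrow> ennreal"
    have [measurable]: "Q \<in> sets borel"
      by (simp add: Q_def)
    \<comment> \<open>The inserted inner integral equals 1 by translation invariance.\<close>
    have "(\<integral>\<^sup>+x. f (T x) \<partial>lborel) = (\<integral>\<^sup>+x. f (T x) * (\<integral>\<^sup>+y. ?h (T x + y) \<partial>lborel) \<partial>lborel)"
      by (simp add: nn_integral_lborel_translate[of ?h] Q1)
    also have "\<dots> = (\<integral>\<^sup>+x. \<integral>\<^sup>+y. f (T x) * ?h (T x + y) \<partial>lborel \<partial>lborel)"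
      by (simp add: nn_integral_cmult)
    also have "\<dots> = (\<integral>\<^sup>+y. \<integral>\<^sup>+x. f (T x) * ?h (T x + y) \<partial>lborel \<partial>lborel)"
      by (rule lborel_pair.Fubini') measurable
    \<comment> \<open>For fixed \<open>y\<close>, shifting \<open>x\<close> by
      \<open>- inv T y\<close> moves \<open>y\<close> from the indicator into
      \<open>f\<close>.\<close>
    also have "\<dots> = (\<integral>\<^sup>+y. \<integral>\<^sup>+x. f (T x - y) * ?h (T x) \<partial>lborel \<partial>lborel)"
    proof (rule nn_integral_cong)
      fix y
      have *: "T (- inv T y + x) = T x - y" for x
        using assms by (simp add: linear_diff bij_is_surj surj_f_inv_f)
      show "(\<integral>\<^sup>+x. f (T x) * ?h (T x + y) \<partial>lborel) = (\<integral>\<^sup>+x. f (T x - y) * ?h (T x) \<partial>lborel)"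
        using nn_integral_lborel_translate[of "\<lambda>x. f (T x) * ?h (T x + y)" "- inv T y"]
        unfolding * by simp
    qed
    also have "\<dots> = (\<integral>\<^sup>+x. \<integral>\<^sup>+y. f (T x - y) * ?h (T x) \<partial>lborel \<partial>lborel)"
      by (rule lborel_pair.Fubini') measurable
    also have "\<dots> = (\<integral>\<^sup>+x. (\<integral>\<^sup>+y. f y \<partial>lborel) * ?h (T x) \<partial>lborel)"
      by (simp add: nn_integral_multc nn_integral_lborel_reflect)
    also have "\<dots> = (\<integral>\<^sup>+y. f y \<partial>lborel) * (\<integral>\<^sup>+x. indicator (T -` Q) x \<partial>lborel)"
      by (simp add: nn_integral_cmult indicator_vimage[symmetric])
    also have "\<dots> = ennreal c * (\<integral>\<^sup>+x. f x \<partial>lborel)"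
      using op c_eq by (simp add: mult.commute)
    finally show ?thesis .
  qed
  then show thesis
    using that c_pos by blast
qed

text \<open>Since the factor is positive, the image measure has the same null sets as
  \<open>lborel\<close>, so the Borel identity extends to the completions.\<close>

lemma lebesgue_linear:
  fixes T :: "'a::euclidean_space \<Rightarrow> 'a"
  assumes "linear T" "bij T"
  obtains c :: real where "0 < c" "T \<in> lebesgue \<rightarrow>\<^sub>M lebesgue"
    "distr lebesgue lebesgue T = density lebesgue (\<lambda>_. ennreal c)"
proof -
  obtain c :: real where c: "0 < c"
    "\<And>f. f \<in> borel_measurable borel \<Longrightarrow> (\<integral>\<^sup>+x. f (T x) \<partial>lborel) = ennreal c * (\<integral>\<^sup>+x. f x \<partial>lborel)"
    using nn_integral_lborel_linear[OF assms] by blast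
  have [measurable]: "T \<in> borel_measurable borel"
    using assms(1) by (intro borel_measurable_continuous_onI) (simp add: linear_continuous_on linear_linear)
  have distr: "distr lebesgue lborel T = density lborel (\<lambda>_. ennreal c)"
  proof -
    have "distr lebesgue lborel T = distr lborel lborel T"
      by (simp add: distr_completion)
    also have "\<dots> = density lborel (\<lambda>_. ennreal c)"
    proof (rule measure_eqI)
      fix A assume "A \<in> sets (distr lborel lborel T)"
      then have [measurable]: "A \<in> sets borel"
        by simp
      have "emeasure (distr lborel lborel T) A = emeasure lborel (T -` A)"
        by (simp add: emeasure_distr)
      also have "\<dots> = (\<integral>\<^sup>+x. indicator A (T x) \<partial>lborel)"
        using measurable_sets_borel[of T borel A] by (simp add: indicator_vimage[symmetric])
      also have "\<dots> = emeasure (density lborel (\<lambda>_. ennreal c)) A"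
        by (simp add: c(2) emeasure_density_const)
      finally show "emeasure (distr lborel lborel T) A = emeasure (density lborel (\<lambda>_. ennreal c)) A" .
    qed simp
    finally show ?thesis .
  qed
  have null: "null_sets (distr lebesgue lborel T) = null_sets lborel"
  proof -
    have "emeasure (density lborel (\<lambda>_. ennreal c)) A = 0 \<longleftrightarrow> emeasure lborel A = 0"
      if "A \<in> sets borel" for A :: "'a set"
      using that c(1) by (subst emeasure_density_const) auto
    then show ?thesis
      unfolding distr null_sets_def by (intro Collect_cong conj_cong) simp_all
  qed
  have "T \<in> lebesgue \<rightarrow>\<^sub>M lebesgue"
    by (rule completion.measurable_completion2) (simp_all add: null measurable_completion)
  moreover have "distr lebesgue lebesgue T = density lebesgue (\<lambda>_. ennreal c)"
  proof -
    have "distr lebesgue lebesgue T = completion (distr lebesgue lborel T)"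
      by (rule completion.completion_distr_eq[symmetric]) (simp_all add: null measurable_completion)
    also have "\<dots> = density lebesgue (\<lambda>_. ennreal c)"
      unfolding distr using c(1) by (intro completion_density_eq) auto
    finally show ?thesis .
  qed
  ultimately show thesis
    using that c(1) by blast
qed

lemma AE_lebesgue_linear:
  fixes T :: "'a::euclidean_space \<Rightarrow> 'a"
  assumes "linear T" "bij T" "AE x in lebesgue. P x"
  shows "AE x in lebesgue. P (T x)"
proof -
  obtain c :: real where c: "0 < c" "T \<in> lebesgue \<rightarrow>\<^sub>M lebesgue"
    "distr lebesgue lebesgue T = density lebesgue (\<lambda>_. ennreal c)"
    using lebesgue_linear[OF assms(1,2)] by blast
  have "AE x in distr lebesgue lebesgue T. P x"
    unfolding c(3) using assms(3) by (subst AE_density) auto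
  then show ?thesis
    by (rule AE_distrD[OF c(2)])
qed

text \<open>Positivity of the factor later transfers vanishing of the integral in both
  directions.\<close>

lemma integral_lebesgue_linear:
  fixes T :: "'a::euclidean_space \<Rightarrow> 'a" and f :: "'a \<Rightarrow> 'b::{banach, second_countable_topology}"
  assumes "linear T" "bij T" and f: "integrable lebesgue f"
  shows "integrable lebesgue (\<lambda>x. f (T x))"
    and "\<exists>c>0. (\<integral>x. f (T x) \<partial>lebesgue) = c *\<^sub>R (\<integral>x. f x \<partial>lebesgue)"
proof -
  obtain c :: real where c: "0 < c" and T: "T \<in> lebesgue \<rightarrow>\<^sub>M lebesgue"
    and eq: "distr lebesgue lebesgue T = density lebesgue (\<lambda>_. ennreal c)"
    using lebesgue_linear[OF assms(1,2)] by blast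
  have [measurable]: "f \<in> borel_measurable lebesgue"
    using f by auto
  show "integrable lebesgue (\<lambda>x. f (T x))"
    using f c by (simp add: integrable_distr_eq[OF T, symmetric] eq integrable_density)
  have "(\<integral>x. f (T x) \<partial>lebesgue) = c *\<^sub>R (\<integral>x. f x \<partial>lebesgue)"
    using c by (simp add: integral_distr[OF T, symmetric] eq integral_density)
  then show "\<exists>c>0. (\<integral>x. f (T x) \<partial>lebesgue) = c *\<^sub>R (\<integral>x. f x \<partial>lebesgue)"
    using c by blast
qed

lemma measurable_lebesgue_minus: "(\<lambda>x::'a::euclidean_space. x - k) \<in> lebesgue \<rightarrow>\<^sub>M lebesgue"
  and distr_lebesgue_minus: "distr lebesgue lebesgue (\<lambda>x::'a. x - k) = lebesgue"
proof -
  \<comment> \<open>The translation in coordinate form, as an affine map with all scaling factors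
    1.\<close>
  have *: "(\<lambda>x::'a. - k + (\<Sum>j\<in>Basis. (1 * (x \<bullet> j)) *\<^sub>R j)) = (\<lambda>x. x - k)"
    by (simp add: euclidean_representation)
  show "(\<lambda>x::'a. x - k) \<in> lebesgue \<rightarrow>\<^sub>M lebesgue"
    using lebesgue_affine_measurable[of "\<lambda>_. 1" "- k"] unfolding * by simp
  show "distr lebesgue lebesgue (\<lambda>x::'a. x - k) = lebesgue"
    using lebesgue_affine_euclidean[of "\<lambda>_. 1" "- k"] unfolding * by (simp add: density_1)
qed

section \<open>Tiling by the unit cube\<close>

lemma countable_int_lattice: "countable (int_lattice :: (real ^ 'n) set)"
proof -
  have "int_lattice \<subseteq> vec_lambda ` (PiE UNIV (\<lambda>_::'n. \<int> :: real set))"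
    by (auto simp: int_lattice_def intro!: image_eqI[where x = "vec_nth _"])
  moreover have "countable (PiE UNIV (\<lambda>_::'n. \<int> :: real set))"
    by (intro countable_PiE) (auto simp: Ints_def)
  ultimately show ?thesis
    by (metis countable_image countable_subset)
qed

text \<open>An enumeration turns the unordered lattice sum into a series. The constant vectors show
  that the lattice is infinite, the index type being nonempty.\<close>

lemma int_lattice_bij:
  obtains e :: "nat \<Rightarrow> real ^ 'n" where "bij_betw e UNIV int_lattice"
proof -
  have "infinite (int_lattice :: (real ^ 'n) set)"
  proof
    assume "finite (int_lattice :: (real ^ 'n) set)"
    then have "finite (range (\<lambda>n::nat. (\<chi> i. real n) :: real ^ 'n))"
      by (rule rev_finite_subset) (auto simp: int_lattice_def)
    moreover have "inj (\<lambda>n::nat. (\<chi> i. real n) :: real ^ 'n)"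
      by (auto simp: inj_def vec_eq_iff)
    ultimately show False
      using finite_imageD by fastforce
  qed
  then show thesis
    using that bij_betw_from_nat_into countable_int_lattice by blast
qed

lemma int_lattice_diff: "k \<in> int_lattice \<Longrightarrow> m \<in> int_lattice \<Longrightarrow> k - m \<in> int_lattice"
  and int_lattice_add: "k \<in> int_lattice \<Longrightarrow> m \<in> int_lattice \<Longrightarrow> k + m \<in> int_lattice"
  by (auto simp: int_lattice_def)

lemma unit_cube_translate_unique:
  assumes "x - k \<in> unit_cube" "x - m \<in> unit_cube" "k \<in> int_lattice" "m \<in> int_lattice"
  shows "k = m"
proof (rule vec_eq_iff[THEN iffD2], rule allI)
  fix i
  \<comment> \<open>A coordinate of x - k in [0,1) forces that of k to be the floor.\<close>
  have "k $ i = of_int \<lfloor>x $ i\<rfloor>" if "x - k \<in> unit_cube" "k \<in> int_lattice" for k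
  proof -
    from that obtain z where "k $ i = of_int z"
      by (auto simp: int_lattice_def Ints_def)
    moreover have "0 \<le> x $ i - k $ i" "x $ i - k $ i < 1"
      using that by (auto simp: unit_cube_def)
    ultimately show ?thesis
      by (simp add: floor_unique)
  qed
  then show "k $ i = m $ i"
    using assms by simp
qed

lemma unit_cube_translate_exists:
  obtains k where "k \<in> int_lattice" "x - k \<in> unit_cube"
proof
  show "(\<chi> i. of_int \<lfloor>x $ i\<rfloor>) \<in> int_lattice" "x - (\<chi> i. of_int \<lfloor>x $ i\<rfloor>) \<in> unit_cube"
    by (auto simp: int_lattice_def unit_cube_def) linarith+
qed

lemma unit_cube_sets [measurable, simp]: "unit_cube \<in> sets (borel :: (real ^ 'n) measure)"
proof -
  have "unit_cube = (\<Inter>i. {x :: real ^ 'n. 0 \<le> x $ i} \<inter> {x. x $ i < 1})"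
    by (auto simp: unit_cube_def)
  also have "\<dots> \<in> sets borel"
    by (intro sets.countable_INT' sets.Int borel_closed borel_open closed_Collect_le open_Collect_less)
       (auto intro!: continuous_intros)
  finally show ?thesis .
qed

text \<open>The half-open cube lies between the open and the closed unit box, both of volume
  1.\<close>

lemma prob_space_unit_cube: "prob_space (lebesgue_on (unit_cube :: (real ^ 'n) set))"
proof
  have "box 0 1 \<subseteq> (unit_cube :: (real ^ 'n) set)" "unit_cube \<subseteq> (cbox 0 1 :: (real ^ 'n) set)"
    by (auto simp: unit_cube_def mem_box_cart less_imp_le)
  then have "emeasure lborel (box 0 1 :: (real ^ 'n) set) \<le> emeasure lborel (unit_cube :: (real ^ 'n) set)"
    "emeasure lborel (unit_cube :: (real ^ 'n) set) \<le> emeasure lborel (cbox 0 1 :: (real ^ 'n) set)"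
    by (auto intro!: emeasure_mono)
  \<comment> \<open>\<open>1\<close> is the all-ones vector, so the boxes have side 1 in every basis
    direction.\<close>
  moreover have "(1 :: real ^ 'n) \<bullet> b = 1" if "b \<in> Basis" for b
    using that by (auto simp: Basis_vec_def inner_axis)
  ultimately have "emeasure lborel (unit_cube :: (real ^ 'n) set) = 1"
    by (simp add: emeasure_lborel_box_eq emeasure_lborel_cbox_eq)
  then show "emeasure (lebesgue_on unit_cube) (space (lebesgue_on (unit_cube :: (real ^ 'n) set))) = 1"
    by (simp add: emeasure_restrict_space)
qed

section \<open>Lattice sums and their integrals over the cube\<close>

lemma integrable_lebesgue_minus:
  fixes f :: "'a::euclidean_space \<Rightarrow> 'b::{banach, second_countable_topology}"
  assumes "integrable lebesgue f"
  shows "integrable lebesgue (\<lambda>x. f (x - k))" "(\<integral>x. f (x - k) \<partial>lebesgue) = (\<integral>x. f x \<partial>lebesgue)"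
proof -
  have "integrable (distr lebesgue lebesgue (\<lambda>x. x - k)) f"
    using assms by (simp add: distr_lebesgue_minus)
  then show "integrable lebesgue (\<lambda>x. f (x - k))"
    by (rule integrable_distr[OF measurable_lebesgue_minus])
  show "(\<integral>x. f (x - k) \<partial>lebesgue) = (\<integral>x. f x \<partial>lebesgue)"
    using integral_distr[OF measurable_lebesgue_minus, of f k] assms
    by (simp add: distr_lebesgue_minus)
qed

lemma AE_lebesgue_minus:
  fixes k :: "'a::euclidean_space"
  assumes "AE x in lebesgue. P x"
  shows "AE x in lebesgue. P (x - k)"
proof -
  have "AE x in distr lebesgue lebesgue (\<lambda>x. x - k). P x"
    using assms unfolding distr_lebesgue_minus .
  then show ?thesis
    by (rule AE_distrD[OF measurable_lebesgue_minus])
qed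

lemma infsum_lattice_shift:
  assumes "m \<in> int_lattice"
  shows "(\<Sum>\<^sub>\<infinity>k\<in>int_lattice. \<phi> (x - m - k)) = (\<Sum>\<^sub>\<infinity>k\<in>int_lattice. \<phi> (x - k))"
proof (rule infsum_reindex_bij_witness[of _ "\<lambda>k. k - m" "\<lambda>k. m + k"])
qed (use assms in \<open>auto intro: int_lattice_diff int_lattice_add simp: algebra_simps\<close>)

text \<open>Unfolding: lattice translates of the cube tile the space, so integrating the lattice sum
  over the cube adds up the integrals of \<phi> over all tiles.\<close>

lemma integral_lattice_sum:
  fixes \<phi> :: "real ^ 'n \<Rightarrow> complex"
  assumes \<phi>: "integrable lebesgue \<phi>"
  shows "integrable (lebesgue_on unit_cube) (\<lambda>x. \<Sum>\<^sub>\<infinity>k\<in>int_lattice. \<phi> (x - k))" (is "integrable _ ?G")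
    and "(\<integral>x. (\<Sum>\<^sub>\<infinity>k\<in>int_lattice. \<phi> (x - k)) \<partial>lebesgue_on unit_cube) = (\<integral>x. \<phi> x \<partial>lebesgue)"
proof -
  obtain e :: "nat \<Rightarrow> real ^ 'n" where e: "bij_betw e UNIV int_lattice"
    by (rule int_lattice_bij)
  then have e_mem: "e n \<in> int_lattice" and e_inj: "e n = e m \<longleftrightarrow> n = m" for n m
    by (auto simp: bij_betw_def inj_eq)
  \<comment> \<open>\<open>A n\<close> is the cube shifted by \<open>- e n\<close>; translation by
    \<open>e n\<close> carries the part of \<phi> on this tile to \<open>f n\<close> below.\<close>
  define A where "A n = {y. y + e n \<in> (unit_cube :: (real ^ 'n) set)}" for n
  have A_sets [measurable]: "A n \<in> sets lebesgue" for n
  proof -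
    have "(\<lambda>y. y + e n) -` (unit_cube :: (real ^ 'n) set) \<in> sets borel"
      by (rule measurable_sets_borel[where M = borel]) auto
    then have "A n \<in> sets borel"
      by (simp add: A_def vimage_def)
    then show ?thesis
      by simp
  qed
  have A_disj: "disjoint_family A"
  proof (clarsimp simp: disjoint_family_on_def)
    fix m n :: nat assume "m \<noteq> n"
    have "m = n" if "y \<in> A m" "y \<in> A n" for y
    proof -
      have "- e m = - e n"
        using that e_mem by (intro unit_cube_translate_unique[of y]) (auto simp: A_def int_lattice_def)
      then show ?thesis
        using e_inj by simp
    qed
    with \<open>m \<noteq> n\<close> show "A m \<inter> A n = {}"
      by auto
  qed
  have A_cover: "(\<Union>n. A n) = UNIV"
  proof safe
    fix y :: "real ^ 'n"
    obtain k where k: "k \<in> int_lattice" "y - k \<in> unit_cube"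
      by (rule unit_cube_translate_exists)
    then have "- k \<in> range e"
      using e by (auto simp: bij_betw_def int_lattice_def)
    then show "y \<in> (\<Union>n. A n)"
      using k by (auto simp: A_def) (metis add.inverse_inverse diff_conv_add_uminus)
  qed auto
  define f where "f n x = indicator unit_cube x *\<^sub>R \<phi> (x - e n)" for n x
  have f_eq: "f n x = (\<lambda>y. indicator (A n) y *\<^sub>R \<phi> y) (x - e n)" for n x
    by (simp add: f_def A_def indicator_def)
  have A_int: "integrable lebesgue (\<lambda>y. indicator (A n) y *\<^sub>R \<phi> y)" for n
    using \<phi> by (intro integrable_mult_indicator) auto
  have f_int: "integrable lebesgue (f n)" for n
    unfolding f_eq[abs_def] by (rule integrable_lebesgue_minus[OF A_int])
  have f_integral: "(\<integral>x. f n x \<partial>lebesgue) = (LINT y:A n|lebesgue. \<phi> y)" for n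
    unfolding f_eq set_lebesgue_integral_def by (rule integrable_lebesgue_minus[OF A_int])
  have norm_integral: "(\<integral>x. norm (f n x) \<partial>lebesgue) = (LINT y:A n|lebesgue. norm (\<phi> y))" for n
    unfolding f_eq set_lebesgue_integral_def using integrable_lebesgue_minus(2)[OF integrable_norm[OF A_int]] by simp
  have norm_int: "integrable lebesgue (\<lambda>y. norm (\<phi> y))"
    using \<phi> by simp
  \<comment> \<open>The tiles are disjoint, so partial sums are bounded by the L^1 norm of
    \<phi>.\<close>
  have norm_sums: "summable (\<lambda>n. \<integral>x. norm (f n x) \<partial>lebesgue)"
  proof (rule summableI_nonneg_bounded)
    fix N
    have "(\<Sum>n<N. \<integral>x. norm (f n x) \<partial>lebesgue) = (LINT y:(\<Union>n<N. A n)|lebesgue. norm (\<phi> y))"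
      unfolding norm_integral
    proof (rule set_integral_finite_UN_AE[symmetric])
      fix n
      show "set_integrable lebesgue (A n) (\<lambda>y. norm (\<phi> y))"
        unfolding set_integrable_def using norm_int by (intro integrable_mult_indicator) auto
      fix m
      show "AE x in lebesgue. x \<in> A n \<and> x \<in> A m \<longrightarrow> n = m"
      proof (rule AE_I2, rule impI)
        fix x assume "x \<in> A n \<and> x \<in> A m"
        then have "A n \<inter> A m \<noteq> {}"
          by blast
        then show "n = m"
          using A_disj unfolding disjoint_family_on_def by (metis UNIV_I)
      qed
    qed (rule finite_lessThan, rule A_sets)
    also have "\<dots> \<le> (\<integral>y. norm (\<phi> y) \<partial>lebesgue)"
      unfolding set_lebesgue_integral_def using norm_int
      by (intro integral_mono integrable_mult_indicator) (auto simp: indicator_def)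
    finally show "(\<Sum>n<N. \<integral>x. norm (f n x) \<partial>lebesgue) \<le> (\<integral>y. norm (\<phi> y) \<partial>lebesgue)" .
  qed simp
  \<comment> \<open>Tonelli: the sum of the norms has a finite integral, hence is finite almost
    everywhere.\<close>
  have ae: "AE x in lebesgue. summable (\<lambda>n. norm (f n x))"
  proof -
    have [measurable]: "f n \<in> borel_measurable lebesgue" for n
      using f_int by auto
    have "(\<integral>\<^sup>+x. (\<Sum>n. ennreal (norm (f n x))) \<partial>lebesgue) = (\<Sum>n. \<integral>\<^sup>+x. ennreal (norm (f n x)) \<partial>lebesgue)"
      by (rule nn_integral_suminf) measurable
    also have "\<dots> = (\<Sum>n. ennreal (\<integral>x. norm (f n x) \<partial>lebesgue))"
      using f_int by (intro suminf_cong nn_integral_eq_integral) auto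
    also have "\<dots> = ennreal (\<Sum>n. \<integral>x. norm (f n x) \<partial>lebesgue)"
      using norm_sums by (intro suminf_ennreal2) auto
    also have "\<dots> \<noteq> \<infinity>"
      by simp
    finally have "(\<integral>\<^sup>+x. (\<Sum>n. ennreal (norm (f n x))) \<partial>lebesgue) \<noteq> \<infinity>" .
    then have "AE x in lebesgue. (\<Sum>n. ennreal (norm (f n x))) \<noteq> \<infinity>"
      by (intro nn_integral_PInf_AE) auto
    then show ?thesis
    proof eventually_elim
      case (elim x)
      then show ?case
        using summable_iff_suminf_neq_top[of "\<lambda>n. norm (f n x)"] by (auto simp: infinity_ennreal_def)
    qed
  qed
  \<comment> \<open>Absolute convergence identifies the series with the unordered sum; off the cube
    both sides are 0.\<close>
  have ae_G: "AE x in lebesgue. (\<Sum>n. f n x) = indicator unit_cube x *\<^sub>R ?G x"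
    using ae
  proof eventually_elim
    case (elim x)
    show ?case
    proof (cases "x \<in> unit_cube")
      case True
      then have "summable (\<lambda>n. norm (\<phi> (x - e n)))"
        using elim by (simp add: f_def)
      then have "((\<lambda>n. \<phi> (x - e n)) has_sum (\<Sum>n. \<phi> (x - e n))) UNIV"
        by (intro norm_summable_imp_has_sum summable_sums) (auto dest: summable_norm_cancel)
      then have "(\<Sum>\<^sub>\<infinity>n. \<phi> (x - e n)) = (\<Sum>n. \<phi> (x - e n))"
        by (rule infsumI)
      moreover have "(\<Sum>\<^sub>\<infinity>n. \<phi> (x - e n)) = ?G x"
        by (rule infsum_reindex_bij_betw[OF e])
      ultimately show ?thesis
        using True by (simp add: f_def)
    qed (simp add: f_def)
  qed
  have S_int: "integrable lebesgue (\<lambda>x. \<Sum>n. f n x)"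
    by (rule integrable_suminf[OF f_int ae norm_sums])
  \<comment> \<open>Completeness of Lebesgue measure lets measurability pass along almost everywhere
    equality.\<close>
  have meas: "(\<lambda>x. indicator unit_cube x *\<^sub>R ?G x) \<in> borel_measurable lebesgue"
    by (rule borel_measurable_AE[OF borel_measurable_integrable[OF S_int] ae_G])
  have "integrable lebesgue (\<lambda>x. indicator unit_cube x *\<^sub>R ?G x)"
    by (rule integrable_cong_AE[OF borel_measurable_integrable[OF S_int] meas ae_G, THEN iffD1, OF S_int])
  then show "integrable (lebesgue_on unit_cube) ?G"
    by (subst integrable_restrict_space) (auto simp: set_integrable_def)
  have "(\<integral>x. ?G x \<partial>lebesgue_on unit_cube) = (\<integral>x. indicator unit_cube x *\<^sub>R ?G x \<partial>lebesgue)"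
    by (subst integral_restrict_space) (auto simp: set_lebesgue_integral_def)
  also have "\<dots> = (\<integral>x. (\<Sum>n. f n x) \<partial>lebesgue)"
    by (rule integral_cong_AE[OF borel_measurable_integrable[OF S_int] meas ae_G, symmetric])
  also have "\<dots> = (\<Sum>n. \<integral>x. f n x \<partial>lebesgue)"
    by (rule integral_suminf[OF f_int ae norm_sums])
  also have "\<dots> = (LINT y:(\<Union>n. A n)|lebesgue. \<phi> y)"
    unfolding f_integral using \<phi> A_disj A_cover
    by (intro lebesgue_integral_countable_add[symmetric]) (auto simp: disjoint_family_on_def set_integrable_def)
  also have "\<dots> = (\<integral>x. \<phi> x \<partial>lebesgue)"
    by (simp add: A_cover set_lebesgue_integral_def)
  finally show "(\<integral>x. ?G x \<partial>lebesgue_on unit_cube) = (\<integral>x. \<phi> x \<partial>lebesgue)" .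
qed

section \<open>Transfer between the periodization and the unit cube\<close>

theorem proposition5:
  fixes b :: "real ^ 'n ^ 'n" and p :: real and \<psi> :: "real ^ 'n \<Rightarrow> complex"
  assumes "invertible b"
    and "0 < p"
    and "\<psi> \<in> Lp_space lebesgue p"
    and "(p < 1 \<and> (cond_a \<psi> \<or> cond_b b \<psi> \<or> cond_c b p \<psi>)) \<or> (p = 1 \<and> cond_a \<psi>)"
  shows "\<exists>c::complex. norm c < 1 \<and>
           (\<lambda>x. c * periodization b \<psi> (b *v x) - 1) \<in> Lp_space (lebesgue_on unit_cube) p \<and>
           Lp_norm (lebesgue_on unit_cube) p (\<lambda>x. c * periodization b \<psi> (b *v x) - 1) < 1"
proof -
  let ?T = "\<lambda>x. b *v x" and ?C = "unit_cube :: (real ^ 'n) set"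
  define g where "g x = periodization b \<psi> (b *v x)" for x
  interpret prob_space "lebesgue_on ?C"
    by (rule prob_space_unit_cube)
  have lin: "linear ?T"
    by (rule matrix_vector_mul_linear)
  have bij: "bij ?T"
    using assms(1) by (simp add: invertible_eq_bij)
  \<comment> \<open>By linearity of \<open>b\<close>, \<open>g\<close> is a multiple of the lattice
    sum of \<psi>(b x), to which unfolding applies.\<close>
  have g_eq: "g x = of_real \<bar>det b\<bar> * (\<Sum>\<^sub>\<infinity>k\<in>int_lattice. \<psi> (b *v (x - k)))" for x
    by (simp add: g_def periodization_def matrix_vector_mult_diff_distrib)
  have AE_cube: "AE x in lebesgue_on ?C. P (g x)" if "AE x in lebesgue. P (periodization b \<psi> x)" for P
  proof -
    have "AE x in lebesgue. x \<in> ?C \<longrightarrow> P (g x)"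
      using AE_lebesgue_linear[OF lin bij that] by eventually_elim (simp add: g_def)
    then show ?thesis
      by (simp add: AE_restrict_space_iff)
  qed
  \<comment> \<open>The two means differ by a nonzero factor, |det b| times that of the
    substitution.\<close>
  have integrable_case: "integrable (lebesgue_on ?C) g \<and>
      ((\<integral>x. g x \<partial>lebesgue_on ?C) = 0 \<longleftrightarrow> (\<integral>x. \<psi> x \<partial>lebesgue) = 0)"
    if \<psi>: "integrable lebesgue \<psi>"
  proof -
    note lin_\<psi> = integral_lebesgue_linear[OF lin bij \<psi>]
    obtain c :: real where c: "0 < c"
      "(\<integral>x. \<psi> (b *v x) \<partial>lebesgue) = c *\<^sub>R (\<integral>x. \<psi> x \<partial>lebesgue)"
      using lin_\<psi>(2) by blast
    have "det b \<noteq> 0"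
      using assms(1) by (simp add: invertible_det_nz)
    then show ?thesis
      unfolding g_eq[abs_def] using integral_lattice_sum[OF lin_\<psi>(1)] c by simp
  qed
  have "approximates_one (lebesgue_on ?C) p g"
  proof -
    consider (a) "p \<le> 1" "cond_a \<psi>" | (b) "p < 1" "cond_b b \<psi>" | (c) "p < 1" "cond_c b p \<psi>"
      using assms(4) by fastforce
    then show ?thesis
    proof cases
      case a
      then show ?thesis
        using integrable_case assms(2) by (intro approximates_one_nonzero_mean) (auto simp: cond_a_def)
    next
      case b
      have g: "integrable (lebesgue_on ?C) g" "(\<integral>x. g x \<partial>lebesgue_on ?C) = 0"
        using integrable_case b by (auto simp: cond_b_def)
      have real: "AE x in lebesgue_on ?C. g x \<in> \<real>"
        using b by (intro AE_cube) (simp add: cond_b_def)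
      \<comment> \<open>\<open>g\<close> is periodic under the lattice, so vanishing on the cube
        would spread to all of the countably many translates, and then through the inverse of
        \<open>b\<close> to the periodization.\<close>
      have nz: "\<not> (AE x in lebesgue_on ?C. g x = 0)"
      proof
        assume "AE x in lebesgue_on ?C. g x = 0"
        then have "AE x in lebesgue. x \<in> ?C \<longrightarrow> g x = 0"
          by (simp add: AE_restrict_space_iff)
        then have "AE x in lebesgue. x - k \<in> ?C \<longrightarrow> g (x - k) = 0" for k
          by (rule AE_lebesgue_minus)
        then have "AE x in lebesgue. \<forall>k\<in>int_lattice. x - k \<in> ?C \<longrightarrow> g (x - k) = 0"
          by (subst AE_ball_countable) (auto simp: countable_int_lattice)
        then have "AE x in lebesgue. g x = 0"
        proof eventually_elim
          case (elim x)
          obtain k where k: "k \<in> int_lattice" "x - k \<in> ?C"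
            by (rule unit_cube_translate_exists)
          then have "g (x - k) = g x"
            unfolding g_eq by (subst infsum_lattice_shift) auto
          then show ?case
            using elim k by auto
        qed
        then have "AE x in lebesgue. g (inv ?T x) = 0"
          by (rule AE_lebesgue_linear[OF inj_linear_imp_inv_linear[OF lin bij_is_inj[OF bij]] bij_imp_bij_inv[OF bij]])
        moreover have "g (inv ?T x) = periodization b \<psi> x" for x
          unfolding g_def surj_f_inv_f[OF bij_is_surj[OF bij]] ..
        ultimately show False
          using b by (simp add: cond_b_def)
      qed
      consider B where "AE x in lebesgue. Re (periodization b \<psi> x) \<le> B"
        | B where "AE x in lebesgue. Re (periodization b \<psi> x) \<ge> B"
        using b unfolding cond_b_def by blast
      then show ?thesis
      proof cases
        case (1 B)
        then have "AE x in lebesgue_on ?C. Re (1 * g x) \<le> B"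
          using AE_cube[of "\<lambda>z. Re z \<le> B"] by simp
        then show ?thesis
          using g nz real assms(2) b by (intro approximates_one_bounded_above[of g 1 B]) simp_all
      next
        case (2 B)
        then have "AE x in lebesgue_on ?C. Re (- 1 * g x) \<le> - B"
          using AE_cube[of "\<lambda>z. Re z \<ge> B"] by simp
        then show ?thesis
          using g nz real assms(2) b by (intro approximates_one_bounded_above[of g "- 1" "- B"]) simp_all
      qed
    next
      case c
      \<comment> \<open>\<open>Lp_loc\<close> speaks of compact sets; the image of the closed cube
        is compact and contains that of the half-open one.\<close>
      define K where "K = ?T ` cbox 0 1"
      have "compact K"
        unfolding K_def using lin
        by (intro compact_continuous_image) (auto simp: linear_continuous_on linear_linear)
      then have K: "K \<in> sets lebesgue"
        by (simp add: borel_compact)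
      have P: "periodization b \<psi> \<in> borel_measurable (lebesgue_on K)"
        "integrable (lebesgue_on K) (\<lambda>x. (norm (periodization b \<psi> x))\<^sup>2)"
        using c(2) \<open>compact K\<close> by (auto simp: cond_c_def Lp_loc_def Lp_space_def)
      have C_K: "b *v x \<in> K" if "x \<in> ?C" for x
        using that by (auto simp: K_def unit_cube_def mem_box_cart less_imp_le)
      have T_meas: "?T \<in> lebesgue \<rightarrow>\<^sub>M lebesgue"
        by (rule lebesgue_linear[OF lin bij])
      have "?T \<in> lebesgue_on ?C \<rightarrow>\<^sub>M lebesgue_on K"
        using T_meas C_K by (intro measurable_restrict_space3) auto
      then have g_meas: "g \<in> borel_measurable (lebesgue_on ?C)"
        unfolding g_def[abs_def] using P(1) by (rule measurable_compose)
      \<comment> \<open>The cutoff to \<open>K\<close> is carried through the substitution because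
        integrability is known there; on the cube it becomes 1.\<close>
      have "integrable lebesgue (\<lambda>y. indicator K y *\<^sub>R (norm (periodization b \<psi> y))\<^sup>2)"
        using P(2) K by (simp add: integrable_restrict_space)
      then have int: "integrable lebesgue (\<lambda>x. indicator K (b *v x) *\<^sub>R (norm (g x))\<^sup>2)"
        unfolding g_def by (rule integral_lebesgue_linear[OF lin bij])
      have "integrable lebesgue (\<lambda>x. indicator ?C x *\<^sub>R (indicator K (b *v x) *\<^sub>R (norm (g x))\<^sup>2))"
        using int by (intro integrable_mult_indicator) auto
      also have "(\<lambda>x. indicator ?C x *\<^sub>R (indicator K (b *v x) *\<^sub>R (norm (g x))\<^sup>2))
          = (\<lambda>x. indicator ?C x *\<^sub>R (norm (g x))\<^sup>2)"
        using C_K by (auto simp: indicator_def fun_eq_iff)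
      finally have "integrable (lebesgue_on ?C) (\<lambda>x. (norm (g x))\<^sup>2)"
        by (simp add: integrable_restrict_space)
      then show ?thesis
        using c g_meas assms(2) by (intro approximates_one_square) (auto simp: cond_c_def g_def)
    qed
  qed
  then show ?thesis
    by (simp add: approximates_one_def g_def)
qed

end
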